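(* Let $\Omega\subseteq\mathbb{R}^d$ be a Borel set, let $\varrho$ be a Borel probability measure on $\Omega$, and let $f,g$ be real-valued functions that are continuous on the closure $\bar\Omega$. Let $\mu=f_*\varrho$ and $\nu=g_*\varrho$ be the pushforward measures on $\mathbb{R}$ (of the restrictions of $f,g$ to $\Omega$). (i) If $f,g\in L^\infty(\Omega,\varrho)$, then for every $p\ge 1$, $$W_p(\mu,\nu)\le \|f-g\|_{L^\infty(\Omega,\varrho)}.$$ (ii) If $\Omega$ is bounded, $p\geq 1$, and $f,g\in L^p(\Omega,\varrho)$, then $$W_p(\mu,\nu)\le \|f-g\|_{L^p(\Omega,\varrho)}.$$
   Context: The pushforward is $f_*\varrho(B)=\varrho(f^{-1}(B))$ for Borel $B\subseteq\mathbb{R}$. For Borel probability measures $\mu,\nu$ on $\mathbb{R}$ with finite $p$-th moments, $1\le p<\infty$, the Wasserstein distance is $W_p(\mu,\nu)=\left[\inf_{\gamma\in\Gamma}\int_{\mathbb{R}^2}|x-y|^p\,d\gamma(x,y)\right]^{1/p}$, where $\Gamma$ is the set of Borel measures on $\mathbb{R}^2$ whose first and second marginals are $\mu$ and $\nu$. *)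

theory Defs
  imports "HOL-Probability.Probability"
begin

text \<open>The \<open>p\<close>-th root on \<open>[0, \<infinity>]\<close>. Norms and distances below take values in \<^typ>\<open>ennreal\<close>, so that an
  infinite integral gives \<open>\<infinity>\<close> and not the value \<open>0\<close> of a total real-valued integral.\<close>

definition ennreal_root :: "real \<Rightarrow> ennreal \<Rightarrow> ennreal" where
  "ennreal_root p x = (if x = \<top> then \<top> else ennreal (enn2real x powr (1 / p)))"

definition Lp_norm :: "real \<Rightarrow> 'a measure \<Rightarrow> ('a \<Rightarrow> real) \<Rightarrow> ennreal" where
  "Lp_norm p M f = ennreal_root p (\<integral>\<^sup>+ x. ennreal (\<bar>f x\<bar> powr p) \<partial>M)"

definition Linf_norm :: "'a measure \<Rightarrow> ('a \<Rightarrow> real) \<Rightarrow> ennreal" where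
  "Linf_norm M f = esssup M (\<lambda>x. ennreal \<bar>f x\<bar>)"

definition Lp_space :: "real \<Rightarrow> 'a measure \<Rightarrow> ('a \<Rightarrow> real) set" where
  "Lp_space p M = {f \<in> borel_measurable M. Lp_norm p M f < \<top>}"

definition Linf_space :: "'a measure \<Rightarrow> ('a \<Rightarrow> real) set" where
  "Linf_space M = {f \<in> borel_measurable M. Linf_norm M f < \<top>}"

definition couplings :: "real measure \<Rightarrow> real measure \<Rightarrow> (real \<times> real) measure set" where
  "couplings \<mu> \<nu> = {\<gamma>. sets \<gamma> = sets borel \<and> distr \<gamma> borel fst = \<mu> \<and> distr \<gamma> borel snd = \<nu>}"

text \<open>Intended for Borel probability measures with finite \<open>p\<close>-th moments and \<open>1 \<le> p < \<infinity>\<close>; the formula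
  is total, with the infimum of the empty set being \<open>\<infinity>\<close>.\<close>

definition Wasserstein :: "real \<Rightarrow> real measure \<Rightarrow> real measure \<Rightarrow> ennreal" where
  "Wasserstein p \<mu> \<nu> =
     ennreal_root p (INF \<gamma>\<in>couplings \<mu> \<nu>. \<integral>\<^sup>+ z. ennreal (\<bar>fst z - snd z\<bar> powr p) \<partial>\<gamma>)"

text \<open>Pushforwards of \<open>L\<^sup>p\<close> and of \<open>L\<^sup>\<infinity>\<close> functions have finite \<open>p\<close>-th moments.\<close>

lemma ennreal_root_less_top_iff [simp]: "ennreal_root p x < \<top> \<longleftrightarrow> x < \<top>"
  by (auto simp: ennreal_root_def less_top[symmetric])

lemma Lp_space_finite_moment:
  assumes "f \<in> Lp_space p M"
  shows "(\<integral>\<^sup>+ y. ennreal (\<bar>y\<bar> powr p) \<partial>distr M borel f) < \<top>"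
  using assms by (auto simp: Lp_space_def Lp_norm_def nn_integral_distr)

lemma Linf_space_finite_moment:
  assumes "prob_space M" "p \<ge> 1" "f \<in> Linf_space M"
  shows "(\<integral>\<^sup>+ y. ennreal (\<bar>y\<bar> powr p) \<partial>distr M borel f) < \<top>"
proof -
  interpret prob_space M by fact
  have f [measurable]: "f \<in> borel_measurable M" and fin: "Linf_norm M f < \<top>"
    using assms(3) by (auto simp: Linf_space_def)
  obtain c where c: "c \<ge> 0" "Linf_norm M f = ennreal c"
    using fin by (cases "Linf_norm M f") auto
  have "AE x in M. ennreal \<bar>f x\<bar> \<le> ennreal c"
    using esssup_AE[of "\<lambda>x. ennreal \<bar>f x\<bar>" M] c by (simp add: Linf_norm_def)
  then have "AE x in M. ennreal (\<bar>f x\<bar> powr p) \<le> ennreal (c powr p)"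
    by eventually_elim (use c assms(2) in \<open>auto intro!: ennreal_leI powr_mono2\<close>)
  then have "(\<integral>\<^sup>+ x. ennreal (\<bar>f x\<bar> powr p) \<partial>M) \<le> (\<integral>\<^sup>+ x. ennreal (c powr p) \<partial>M)"
    by (rule nn_integral_mono_AE)
  also have "\<dots> < \<top>"
    by (simp add: emeasure_space_1)
  finally show ?thesis
    by (simp add: nn_integral_distr)
qed

end

theory Submission
  imports Defs
begin

text \<open>The law of \<open>(f, g)\<close> under \<open>\<rho>\<close> is a coupling of the two pushforwards, and its transport cost is the
  \<open>p\<close>-th power of the \<open>L\<^sup>p\<close> norm of \<open>f - g\<close>. This gives (ii), and (i) follows because on a probability
  space the \<open>L\<^sup>p\<close> norm is at most the \<open>L\<^sup>\<infinity>\<close> norm.\<close>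

lemma ennreal_root_mono:
  assumes "p > 0" "x \<le> y"
  shows "ennreal_root p x \<le> ennreal_root p y"
\<comment> \<open>\<open>enn2real\<close> sends \<open>\<top>\<close> to 0, so its monotonicity is
  available only below a finite \<open>y\<close>; for \<open>y = \<top>\<close> the right-hand side
  is \<open>\<top>\<close>.\<close>
proof (cases "y = \<top>")
  case False
  with assms(2) have "enn2real x \<le> enn2real y" "x \<noteq> \<top>"
    by (auto simp: enn2real_mono less_top top_unique)
  with assms(1) False show ?thesis
    by (auto simp: ennreal_root_def intro!: ennreal_leI powr_mono2)
qed (simp add: ennreal_root_def)

lemma ennreal_root_powr:
  assumes "p > 0" "c \<ge> 0"
  shows "ennreal_root p (ennreal (c powr p)) = ennreal c"
  using assms by (simp add: ennreal_root_def powr_powr)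

text \<open>Pushing forward along the pair and then along a projection is pushing forward along the
  component, so the marginals are the two given laws. The projections are Borel because they are
  continuous.\<close>

lemma distr_Pair_in_couplings:
  assumes [measurable]: "f \<in> borel_measurable M" "g \<in> borel_measurable M"
  shows "distr M borel (\<lambda>x. (f x, g x)) \<in> couplings (distr M borel f) (distr M borel g)"
  by (simp add: couplings_def distr_distr borel_measurable_continuous_onI
      continuous_on_fst continuous_on_snd comp_def)

lemma Wasserstein_distr_le_Lp_norm:
  assumes "p > 0"
    and [measurable]: "f \<in> borel_measurable M" "g \<in> borel_measurable M"
  shows "Wasserstein p (distr M borel f) (distr M borel g) \<le> Lp_norm p M (\<lambda>x. f x - g x)"
proof -
  let ?\<gamma> = "distr M borel (\<lambda>x. (f x, g x))"
  \<comment> \<open>The plane carries \<open>borel\<close> of the product type, as in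
    \<open>couplings\<close>, rather than a product of two sigma-algebras; measurability of the cost
    then follows from continuity.\<close>
  have [measurable]: "(\<lambda>z::real \<times> real. \<bar>fst z - snd z\<bar>) \<in> borel_measurable borel"
    by (intro borel_measurable_continuous_onI continuous_intros)
  have "(\<integral>\<^sup>+ z. ennreal (\<bar>fst z - snd z\<bar> powr p) \<partial>?\<gamma>)
      = (\<integral>\<^sup>+ x. ennreal (\<bar>f x - g x\<bar> powr p) \<partial>M)"
    by (simp add: nn_integral_distr)
  \<comment> \<open>The infimum is at most the cost of the one coupling \<open>?\<gamma>\<close>,
    which the change of variables has just computed.\<close>
  then have "(INF \<gamma>\<in>couplings (distr M borel f) (distr M borel g).
        \<integral>\<^sup>+ z. ennreal (\<bar>fst z - snd z\<bar> powr p) \<partial>\<gamma>)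
      \<le> (\<integral>\<^sup>+ x. ennreal (\<bar>f x - g x\<bar> powr p) \<partial>M)"
    by (intro INF_lower2[OF distr_Pair_in_couplings]) auto
  then show ?thesis
    unfolding Wasserstein_def Lp_norm_def using assms(1) by (rule ennreal_root_mono[rotated])
qed

text \<open>If the essential supremum is a finite \<open>c\<close>, then \<open>c powr p\<close>
  dominates the integrand almost everywhere. Since the total mass is 1, it also bounds the integral,
  and its \<open>p\<close>-th root is \<open>c\<close>. An infinite essential supremum makes the
  bound trivial.\<close>

lemma (in prob_space) Lp_norm_le_Linf_norm:
  assumes "p > 0" and [measurable]: "f \<in> borel_measurable M"
  shows "Lp_norm p M f \<le> Linf_norm M f"
proof (cases "Linf_norm M f")
  case (real c)
  have "AE x in M. ennreal \<bar>f x\<bar> \<le> ennreal c"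
    using esssup_AE[of "\<lambda>x. ennreal \<bar>f x\<bar>" M] real by (simp add: Linf_norm_def)
  then have "AE x in M. ennreal (\<bar>f x\<bar> powr p) \<le> ennreal (c powr p)"
    by eventually_elim (use real assms(1) in \<open>auto intro!: ennreal_leI powr_mono2\<close>)
  then have "(\<integral>\<^sup>+ x. ennreal (\<bar>f x\<bar> powr p) \<partial>M) \<le> (\<integral>\<^sup>+ x. ennreal (c powr p) \<partial>M)"
    by (rule nn_integral_mono_AE)
  then have "(\<integral>\<^sup>+ x. ennreal (\<bar>f x\<bar> powr p) \<partial>M) \<le> ennreal (c powr p)"
    by (simp add: emeasure_space_1)
  then have "Lp_norm p M f \<le> ennreal_root p (ennreal (c powr p))"
    unfolding Lp_norm_def using assms(1) by (rule ennreal_root_mono[rotated])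
  with real assms(1) show ?thesis
    by (simp add: ennreal_root_powr)
qed simp

theorem theorem2:
  fixes \<Omega> :: "(real ^ 'd) set"
    and \<rho> :: "(real ^ 'd) measure"
    and f g :: "real ^ 'd \<Rightarrow> real"
  assumes "\<Omega> \<in> sets borel"
    and "prob_space \<rho>"
    and "sets \<rho> = sets (restrict_space borel \<Omega>)"
    and "continuous_on (closure \<Omega>) f"
    and "continuous_on (closure \<Omega>) g"
  shows "(f \<in> Linf_space \<rho> \<and> g \<in> Linf_space \<rho> \<longrightarrow>
           (\<forall>p\<ge>1. Wasserstein p (distr \<rho> borel f) (distr \<rho> borel g) \<le> Linf_norm \<rho> (\<lambda>x. f x - g x)))
       \<and> (\<forall>p\<ge>1. bounded \<Omega> \<and> f \<in> Lp_space p \<rho> \<and> g \<in> Lp_space p \<rho> \<longrightarrow>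
           Wasserstein p (distr \<rho> borel f) (distr \<rho> borel g) \<le> Lp_norm p \<rho> (\<lambda>x. f x - g x))"
proof (intro conjI impI allI)
  fix p :: real
  assume "f \<in> Linf_space \<rho> \<and> g \<in> Linf_space \<rho>" and p: "p \<ge> 1"
  \<comment> \<open>Measurability with respect to \<open>\<rho>\<close>, a measure on
    \<open>\<Omega>\<close>, is part of membership in \<open>Linf_space\<close>.\<close>
  then have [measurable]: "f \<in> borel_measurable \<rho>" "g \<in> borel_measurable \<rho>"
    by (auto simp: Linf_space_def)
  have "Wasserstein p (distr \<rho> borel f) (distr \<rho> borel g) \<le> Lp_norm p \<rho> (\<lambda>x. f x - g x)"
    using p by (intro Wasserstein_distr_le_Lp_norm) auto
  also have "\<dots> \<le> Linf_norm \<rho> (\<lambda>x. f x - g x)"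
    using p by (intro prob_space.Lp_norm_le_Linf_norm assms(2)) auto
  finally show "Wasserstein p (distr \<rho> borel f) (distr \<rho> borel g) \<le> Linf_norm \<rho> (\<lambda>x. f x - g x)" .
next
  fix p :: real
  assume "p \<ge> 1" "bounded \<Omega> \<and> f \<in> Lp_space p \<rho> \<and> g \<in> Lp_space p \<rho>"
  then show "Wasserstein p (distr \<rho> borel f) (distr \<rho> borel g) \<le> Lp_norm p \<rho> (\<lambda>x. f x - g x)"
    by (intro Wasserstein_distr_le_Lp_norm) (auto simp: Lp_space_def)
qed

end
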